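(* Let $s\ge1$ and let $a_{ij},b_i$ ($i,j=1,\dots,s$) be real numbers satisfying $$b_ia_{ij}+b_ja_{ji}=b_ib_j,\qquad\forall\, i,j=1,\dots,s.$$ Let $(\boldsymbol{B}^n,\boldsymbol{\rho}^n,\boldsymbol{u}^n,\boldsymbol{\phi}^n)_{n\ge0}$ in $\mathbb{V}_h$ be generated by the fully discrete Runge–Kutta scheme with these coefficients (the scheme described in the context), with $\boldsymbol{\phi}^0=|\boldsymbol{B}^0|^2$. Then for all $n=0,1,2,\dots$: (i) the discrete mass is conserved: $\mathcal{M}_h^{n+1}=\mathcal{M}_h^n$, where $\mathcal{M}_h^n=\langle|\boldsymbol{B}^n|^2,\boldsymbol{1}\rangle_h$; (ii) two discrete quadratic invariants are conserved: $\boldsymbol{H}_{1,h}^{n+1}=\boldsymbol{H}_{1,h}^n=0$ and $\mathcal{E}_h^{n+1}=\mathcal{E}_h^n$, where $\boldsymbol{H}_{1,h}^n=\boldsymbol{\phi}^n-|\boldsymbol{B}^n|^2\in\mathbb{V}_h$ and $$\mathcal{E}_h^n=\omega\langle\mathcal{D}_2\boldsymbol{B}^n,\boldsymbol{B}^n\rangle_h-\kappa\langle\boldsymbol{u}^n-\tfrac\nu2\boldsymbol{\rho}^n+\tfrac q2\boldsymbol{\phi}^n,\boldsymbol{\phi}^n\rangle_h-\tfrac\beta2\langle\boldsymbol{\rho}^n,\boldsymbol{\rho}^n\rangle_h-\tfrac12\langle\boldsymbol{u}^n,\boldsymbol{u}^n\rangle_h+\nu\langle\boldsymbol{u}^n,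\boldsymbol{\rho}^n\rangle_h.$$
   Context: $\omega,\kappa,\nu,\beta,q$ are given real constants with $q=\kappa+\frac{\nu(\kappa\nu-1)}{4(\beta-\nu^2)}$ (so $\beta\ne\nu^2$). $\Omega=[a,b]$, $N$ is a positive even integer, $h=(b-a)/N$, $x_j=a+jh$, $\mu=\frac{2\pi}{b-a}$, and $\tau>0$ is the time step. $\mathbb{V}_h$ is the space of periodic mesh functions, written as vectors $\boldsymbol{U}=(U_0,\dots,U_{N-1})^T$; the $\boldsymbol{B}$-variables have complex entries, while the $\boldsymbol{\rho},\boldsymbol{u},\boldsymbol{\phi}$-variables (including internal stages) have real entries. $\langle\boldsymbol{U},\boldsymbol{V}\rangle_h=h\sum_{j=0}^{N-1}U_j\bar V_j$; $\boldsymbol{U}\cdot\boldsymbol{V}$ is the componentwise product; $|\boldsymbol{U}|^2=\boldsymbol{U}\cdot\bar{\boldsymbol{U}}$ (componentwise); $\boldsymbol{1}=(1,\dots,1)^T\in\mathbb{R}^N$; $\mathrm{Re}$ is taken componentwise. Fourier pseudo-spectral differentiation matrices: $(\mathcal{D}_m)_{j,k}=\frac{d^m g_k}{dx^m}(x_j)$, $j,k=0,\dots,N-1$, where $g_j(x)=\frac1N\sum_{l=-N/2}^{N/2}\frac1{c_l}e^{\mathrm{i}l\mu(x-x_j)}$ with $c_l=1$ for $|l|<N/2$ and $c_l=2$ for $|l|=N/2$. Equivalently, $\mathcal{D}_1=\mathcal{F}_N^H\Lambda^1\mathcal{F}_N$ and $\mathcal{D}_2=\mathcal{F}_N^H\Lambda^2\mathcal{F}_N$,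 with $(\mathcal{F}_N)_{j,k}=\frac1{\sqrt N}e^{-\mathrm{i}jk\frac{2\pi}{N}}$, $\mathcal{F}_N^H$ its conjugate transpose, $\Lambda^1=\mathrm{i}\mu\,\mathrm{diag}(0,1,\dots,\frac N2-1,0,-\frac N2+1,\dots,-1)$ and $\Lambda^2=[\mathrm{i}\mu\,\mathrm{diag}(0,1,\dots,\frac N2-1,\frac N2,-\frac N2+1,\dots,-1)]^2$. Scheme ($s$-stage Runge–Kutta method with real coefficients $b_i,a_{ij}$, and $c_i=\sum_{j=1}^sa_{ij}$): given $\boldsymbol{B}^n,\boldsymbol{\rho}^n,\boldsymbol{u}^n,\boldsymbol{\phi}^n\in\mathbb{V}_h$, the stages satisfy, for $i=1,\dots,s$, $$\begin{aligned}&\boldsymbol{B}_{ni}=\boldsymbol{B}^n+\tau\sum_{j=1}^sa_{ij}k_j^1,& &k_i^1=\mathrm{i}\big(\omega\mathcal{D}_2\boldsymbol{B}_{ni}-\kappa(\boldsymbol{u}_{ni}-\tfrac12\nu\boldsymbol{\rho}_{ni}+q\boldsymbol{\phi}_{ni})\cdot\boldsymbol{B}_{ni}\big),\\&\boldsymbol{\rho}_{ni}=\boldsymbol{\rho}^n+\tau\sum_{j=1}^sa_{ij}k_j^2,& &k_i^2=\mathcal{D}_1\big(-\boldsymbol{u}_{ni}+\nu\boldsymbol{\rho}_{ni}-\kappa\boldsymbol{\phi}_{ni}\big),\\&\boldsymbol{u}_{ni}=\boldsymbol{u}^n+\tau\sum_{j=1}^sa_{ij}k_j^3,& &k_i^3=\mathcal{D}_1\big(-\beta\boldsymbol{\rho}_{ni}+\nu\boldsymbol{u}_{ni}+\tfrac12\kappa\nu\boldsymbol{\phi}_{ni}\big),\\&\boldsymbol{\phi}_{ni}=\boldsymbol{\phi}^n+\tau\sum_{j=1}^sa_{ij}k_j^4,&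 &k_i^4=2\,\mathrm{Re}(\bar{\boldsymbol{B}}_{ni}\cdot k_i^1),\end{aligned}$$ and the update is $\boldsymbol{B}^{n+1}=\boldsymbol{B}^n+\tau\sum_{i=1}^sb_ik_i^1$, $\boldsymbol{\rho}^{n+1}=\boldsymbol{\rho}^n+\tau\sum_{i=1}^sb_ik_i^2$, $\boldsymbol{u}^{n+1}=\boldsymbol{u}^n+\tau\sum_{i=1}^sb_ik_i^3$, $\boldsymbol{\phi}^{n+1}=\boldsymbol{\phi}^n+\tau\sum_{i=1}^sb_ik_i^4$. A sequence is "generated by the scheme" if at each step some stage values satisfying these (implicit) equations exist and give the update. *)

theory Defs
  imports "HOL-Analysis.Analysis"
begin

text \<open>
  A mesh function in \<open>V\<^sub>h\<close> is represented by a function on \<^typ>\<open>nat\<close> of which only the entries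
  \<open>0, \<dots>, N - 1\<close> matter; equality of mesh functions is equality of these entries.
  The interval is \<open>[a, b]\<close>; the Runge--Kutta coefficients \<open>a\<^sub>i\<^sub>j\<close>, \<open>b\<^sub>i\<close> are written \<open>A i j\<close>, \<open>w i\<close>
  with indices in \<open>{1..s}\<close>.
\<close>

definition mesh_size :: "real \<Rightarrow> real \<Rightarrow> nat \<Rightarrow> real" where
  "mesh_size a b N = (b - a) / real N"

definition mesh_point :: "real \<Rightarrow> real \<Rightarrow> nat \<Rightarrow> nat \<Rightarrow> real" where
  "mesh_point a b N j = a + real j * mesh_size a b N"

definition freq_weight :: "nat \<Rightarrow> int \<Rightarrow> real" where
  "freq_weight N l = (if \<bar>l\<bar> = int (N div 2) then 2 else 1)"

definition interp_basis :: "real \<Rightarrow> real \<Rightarrow> nat \<Rightarrow> nat \<Rightarrow> real \<Rightarrow> complex" where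
  "interp_basis a b N k x =
     1 / of_nat N * (\<Sum>l = - int (N div 2)..int (N div 2).
       1 / complex_of_real (freq_weight N l) *
       exp (\<i> * complex_of_real (of_int l * (2 * pi / (b - a)) * (x - mesh_point a b N k))))"

definition diff_matrix :: "real \<Rightarrow> real \<Rightarrow> nat \<Rightarrow> nat \<Rightarrow> nat \<Rightarrow> nat \<Rightarrow> complex" where
  "diff_matrix a b N m j k =
     ((\<lambda>g x. vector_derivative g (at x)) ^^ m) (interp_basis a b N k) (mesh_point a b N j)"

definition diff_op :: "real \<Rightarrow> real \<Rightarrow> nat \<Rightarrow> nat \<Rightarrow> (nat \<Rightarrow> complex) \<Rightarrow> nat \<Rightarrow> complex" where
  "diff_op a b N m U j = (\<Sum>k<N. diff_matrix a b N m j k * U k)"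

definition inner_h :: "real \<Rightarrow> real \<Rightarrow> nat \<Rightarrow> (nat \<Rightarrow> complex) \<Rightarrow> (nat \<Rightarrow> complex) \<Rightarrow> complex" where
  "inner_h a b N U V = complex_of_real (mesh_size a b N) * (\<Sum>j<N. U j * cnj (V j))"

definition abs_sq :: "(nat \<Rightarrow> complex) \<Rightarrow> nat \<Rightarrow> complex" where
  "abs_sq U j = U j * cnj (U j)"

text \<open>
  Since \<^const>\<open>diff_matrix\<close> is formally complex, the equations for \<open>k\<^sup>2\<close> and \<open>k\<^sup>3\<close> are stated between
  complex numbers; the real type of \<open>k2\<close>, \<open>k3\<close> is no restriction, the entries of \<open>D\<^sub>1\<close> being real.
\<close>

definition rk_step ::
  "real \<Rightarrow> real \<Rightarrow> real \<Rightarrow> real \<Rightarrow> real \<Rightarrow> real \<Rightarrow> real \<Rightarrow> nat \<Rightarrow> real \<Rightarrow>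
   nat \<Rightarrow> (nat \<Rightarrow> nat \<Rightarrow> real) \<Rightarrow> (nat \<Rightarrow> real) \<Rightarrow>
   (nat \<Rightarrow> complex) \<Rightarrow> (nat \<Rightarrow> real) \<Rightarrow> (nat \<Rightarrow> real) \<Rightarrow> (nat \<Rightarrow> real) \<Rightarrow>
   (nat \<Rightarrow> complex) \<Rightarrow> (nat \<Rightarrow> real) \<Rightarrow> (nat \<Rightarrow> real) \<Rightarrow> (nat \<Rightarrow> real) \<Rightarrow> bool" where
  "rk_step \<omega> \<kappa> \<nu> \<beta> q a b N \<tau> s A w B \<rho> u \<phi> B' \<rho>' u' \<phi>' \<longleftrightarrow>
    (\<exists>(Bs :: nat \<Rightarrow> nat \<Rightarrow> complex) (\<rho>s :: nat \<Rightarrow> nat \<Rightarrow> real)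
      (us :: nat \<Rightarrow> nat \<Rightarrow> real) (\<phi>s :: nat \<Rightarrow> nat \<Rightarrow> real)
      (k1 :: nat \<Rightarrow> nat \<Rightarrow> complex) (k2 :: nat \<Rightarrow> nat \<Rightarrow> real)
      (k3 :: nat \<Rightarrow> nat \<Rightarrow> real) (k4 :: nat \<Rightarrow> nat \<Rightarrow> real).
      (\<forall>i\<in>{1..s}. \<forall>j<N.
         Bs i j = B j + complex_of_real \<tau> * (\<Sum>m = 1..s. complex_of_real (A i m) * k1 m j) \<and>
         \<rho>s i j = \<rho> j + \<tau> * (\<Sum>m = 1..s. A i m * k2 m j) \<and>
         us i j = u j + \<tau> * (\<Sum>m = 1..s. A i m * k3 m j) \<and>
         \<phi>s i j = \<phi> j + \<tau> * (\<Sum>m = 1..s. A i m * k4 m j) \<and>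
         k1 i j = \<i> * (complex_of_real \<omega> * diff_op a b N 2 (Bs i) j
                    - complex_of_real (\<kappa> * (us i j - 1/2 * \<nu> * \<rho>s i j + q * \<phi>s i j)) * Bs i j) \<and>
         complex_of_real (k2 i j) =
           diff_op a b N 1
             (\<lambda>l. complex_of_real (- us i l + \<nu> * \<rho>s i l - \<kappa> * \<phi>s i l)) j \<and>
         complex_of_real (k3 i j) =
           diff_op a b N 1
             (\<lambda>l. complex_of_real (- \<beta> * \<rho>s i l + \<nu> * us i l + 1/2 * \<kappa> * \<nu> * \<phi>s i l)) j \<and>
         k4 i j = 2 * Re (cnj (Bs i j) * k1 i j)) \<and>
      (\<forall>j<N.
         B' j = B j + complex_of_real \<tau> * (\<Sum>i = 1..s. complex_of_real (w i) * k1 i j) \<and>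
         \<rho>' j = \<rho> j + \<tau> * (\<Sum>i = 1..s. w i * k2 i j) \<and>
         u' j = u j + \<tau> * (\<Sum>i = 1..s. w i * k3 i j) \<and>
         \<phi>' j = \<phi> j + \<tau> * (\<Sum>i = 1..s. w i * k4 i j)))"

definition mass_h :: "real \<Rightarrow> real \<Rightarrow> nat \<Rightarrow> (nat \<Rightarrow> complex) \<Rightarrow> complex" where
  "mass_h a b N B = inner_h a b N (abs_sq B) (\<lambda>_. 1)"

definition H1_h :: "(nat \<Rightarrow> complex) \<Rightarrow> (nat \<Rightarrow> real) \<Rightarrow> nat \<Rightarrow> complex" where
  "H1_h B \<phi> j = complex_of_real (\<phi> j) - abs_sq B j"

definition energy_h ::
  "real \<Rightarrow> real \<Rightarrow> real \<Rightarrow> real \<Rightarrow> real \<Rightarrow> real \<Rightarrow> real \<Rightarrow> nat \<Rightarrow>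
   (nat \<Rightarrow> complex) \<Rightarrow> (nat \<Rightarrow> real) \<Rightarrow> (nat \<Rightarrow> real) \<Rightarrow> (nat \<Rightarrow> real) \<Rightarrow> complex" where
  "energy_h \<omega> \<kappa> \<nu> \<beta> q a b N B \<rho> u \<phi> =
     complex_of_real \<omega> * inner_h a b N (diff_op a b N 2 B) B
     - complex_of_real \<kappa> *
         inner_h a b N (\<lambda>j. complex_of_real (u j - \<nu> / 2 * \<rho> j + q / 2 * \<phi> j))
                       (\<lambda>j. complex_of_real (\<phi> j))
     - complex_of_real (\<beta> / 2) *
         inner_h a b N (\<lambda>j. complex_of_real (\<rho> j)) (\<lambda>j. complex_of_real (\<rho> j))
     - complex_of_real (1 / 2) *
         inner_h a b N (\<lambda>j. complex_of_real (u j)) (\<lambda>j. complex_of_real (u j))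
     + complex_of_real \<nu> *
         inner_h a b N (\<lambda>j. complex_of_real (u j)) (\<lambda>j. complex_of_real (\<rho> j))"

end

theory Submission
  imports Defs
begin

text \<open>
  Every product of two Runge--Kutta components changes in one step by exactly
  \<open>\<tau> * (\<Sum>i. w i * (derivative of the product at stage i))\<close>, by the condition on the coefficients.
  So a quadratic invariant of the semi-discrete system is conserved as soon as its rate of change
  vanishes at each stage. The matrix \<open>D\<^sub>2\<close> is real symmetric, which makes the mass rate vanish; the
  matrix \<open>D\<^sub>1\<close> is antisymmetric and \<open>k\<^sup>2 = D\<^sub>1 P\<close>, \<open>k\<^sup>3 = D\<^sub>1 Q\<close> with \<open>P = \<partial>E/\<partial>u\<close> and \<open>Q = \<partial>E/\<partial>\<rho>\<close>,
  which cancels the \<open>\<rho>\<close>, \<open>u\<close> part of the energy rate; the rest cancels pointwise, because \<open>k\<^sup>1\<close> is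
  \<open>\<i>\<close> times the gradient in \<open>B\<close>.
\<close>

section \<open>Products of Runge-Kutta components\<close>

text \<open>The relation is scalar and leaves the increments \<open>k\<close> arbitrary, so it fits
  a mesh entry, its conjugate and an entry of a matrix image alike.\<close>

definition rk_update ::
  "'a::comm_ring_1 \<Rightarrow> nat set \<Rightarrow> (nat \<Rightarrow> nat \<Rightarrow> 'a) \<Rightarrow> (nat \<Rightarrow> 'a) \<Rightarrow>
   'a \<Rightarrow> (nat \<Rightarrow> 'a) \<Rightarrow> (nat \<Rightarrow> 'a) \<Rightarrow> 'a \<Rightarrow> bool" where
  "rk_update \<tau> I A w x X k x' \<longleftrightarrow>
     (\<forall>i\<in>I. X i = x + \<tau> * (\<Sum>m\<in>I. A i m * k m)) \<and> x' = x + \<tau> * (\<Sum>i\<in>I. w i * k i)"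

text \<open>Inserting the stage equations into the right-hand side produces two double sums. By the
  condition on the coefficients they combine into the product of the two weighted increment sums,
  which is the second-order term of \<open>x' * y'\<close>.\<close>

lemma rk_update_mult:
  assumes x: "rk_update \<tau> I A w x X k x'" and y: "rk_update \<tau> I A w y Y l y'"
    and symp: "\<And>i j. i \<in> I \<Longrightarrow> j \<in> I \<Longrightarrow> w i * A i j + w j * A j i = w i * w j"
  shows "x' * y' = x * y + \<tau> * (\<Sum>i\<in>I. w i * (X i * l i + k i * Y i))"
proof -
  have "(\<Sum>i\<in>I. w i * (X i * l i + k i * Y i)) =
        (\<Sum>i\<in>I. w i * (x * l i + k i * y) +
           (\<tau> * (\<Sum>m\<in>I. w i * A i m * (k m * l i)) + \<tau> * (\<Sum>m\<in>I. w i * A i m * (k i * l m))))"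
  proof (rule sum.cong[OF refl])
    fix i assume "i \<in> I"
    then have X: "X i = x + \<tau> * (\<Sum>m\<in>I. A i m * k m)" and Y: "Y i = y + \<tau> * (\<Sum>m\<in>I. A i m * l m)"
      using x y by (auto simp: rk_update_def)
    have "(\<Sum>m\<in>I. w i * A i m * (k m * l i)) = w i * l i * (\<Sum>m\<in>I. A i m * k m)"
      and "(\<Sum>m\<in>I. w i * A i m * (k i * l m)) = w i * k i * (\<Sum>m\<in>I. A i m * l m)"
      by (simp_all add: sum_distrib_left mult_ac)
    then show "w i * (X i * l i + k i * Y i) = w i * (x * l i + k i * y) +
      (\<tau> * (\<Sum>m\<in>I. w i * A i m * (k m * l i)) + \<tau> * (\<Sum>m\<in>I. w i * A i m * (k i * l m)))"
      unfolding X Y by (simp add: algebra_simps)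
  qed
  also have "\<dots> = (\<Sum>i\<in>I. w i * (x * l i + k i * y)) +
      \<tau> * ((\<Sum>i\<in>I. \<Sum>m\<in>I. w i * A i m * (k m * l i)) + (\<Sum>i\<in>I. \<Sum>m\<in>I. w i * A i m * (k i * l m)))"
    by (simp add: sum.distrib sum_distrib_left distrib_left)
  \<comment> \<open>Exchanging the roles of the indices brings both double sums to the common factor
    \<open>k i * l m\<close>, so that the coefficients add up as in \<open>symp\<close>.\<close>
  also have "(\<Sum>i\<in>I. \<Sum>m\<in>I. w i * A i m * (k m * l i)) = (\<Sum>i\<in>I. \<Sum>m\<in>I. w m * A m i * (k i * l m))"
    by (rule sum.swap)
  also have "\<dots> + (\<Sum>i\<in>I. \<Sum>m\<in>I. w i * A i m * (k i * l m)) =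
             (\<Sum>i\<in>I. \<Sum>m\<in>I. (w i * A i m + w m * A m i) * (k i * l m))"
    by (simp add: sum.distrib[symmetric] algebra_simps)
  also have "\<dots> = (\<Sum>i\<in>I. \<Sum>m\<in>I. (w i * w m) * (k i * l m))"
    using symp by simp
  also have "\<dots> = (\<Sum>i\<in>I. w i * k i) * (\<Sum>i\<in>I. w i * l i)"
    by (simp add: sum_product mult_ac)
  finally have rate: "(\<Sum>i\<in>I. w i * (X i * l i + k i * Y i)) =
      (\<Sum>i\<in>I. w i * (x * l i + k i * y)) + \<tau> * ((\<Sum>i\<in>I. w i * k i) * (\<Sum>i\<in>I. w i * l i))" .
  have "(\<Sum>i\<in>I. w i * (x * l i + k i * y)) = x * (\<Sum>i\<in>I. w i * l i) + (\<Sum>i\<in>I. w i * k i) * y"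
    by (simp add: sum.distrib sum_distrib_left sum_distrib_right algebra_simps)
  then show ?thesis
    using x y unfolding rate by (simp add: rk_update_def algebra_simps)
qed

lemma rk_update_of_real:
  assumes "\<forall>i\<in>I. X i = x + \<tau> * (\<Sum>m\<in>I. A i m * k m)" and "x' = x + \<tau> * (\<Sum>i\<in>I. w i * k i)"
  shows "rk_update (complex_of_real \<tau>) I (\<lambda>i j. complex_of_real (A i j)) (\<lambda>i. complex_of_real (w i))
           (complex_of_real x) (\<lambda>i. complex_of_real (X i)) (\<lambda>i. complex_of_real (k i)) (complex_of_real x')"
  using assms by (simp add: rk_update_def)

lemma rk_update_cnj:
  assumes "rk_update (complex_of_real \<tau>) I (\<lambda>i j. complex_of_real (A i j)) (\<lambda>i. complex_of_real (w i)) x X k x'"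
  shows "rk_update (complex_of_real \<tau>) I (\<lambda>i j. complex_of_real (A i j)) (\<lambda>i. complex_of_real (w i))
           (cnj x) (\<lambda>i. cnj (X i)) (\<lambda>i. cnj (k i)) (cnj x')"
  using assms by (simp add: rk_update_def)

lemma sum_linear_combination:
  fixes c :: "'i \<Rightarrow> 'a::comm_ring_1"
  shows "(\<Sum>l\<in>L. c l * (x l + t * (\<Sum>m\<in>I. d m * k m l))) =
         (\<Sum>l\<in>L. c l * x l) + t * (\<Sum>m\<in>I. d m * (\<Sum>l\<in>L. c l * k m l))"
proof -
  have "(\<Sum>l\<in>L. c l * (t * (\<Sum>m\<in>I. d m * k m l))) = (\<Sum>l\<in>L. \<Sum>m\<in>I. t * (d m * (c l * k m l)))"
    by (simp add: sum_distrib_left mult_ac)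
  also have "\<dots> = (\<Sum>m\<in>I. \<Sum>l\<in>L. t * (d m * (c l * k m l)))"
    by (rule sum.swap)
  also have "\<dots> = t * (\<Sum>m\<in>I. d m * (\<Sum>l\<in>L. c l * k m l))"
    by (simp add: sum_distrib_left)
  finally show ?thesis by (simp add: distrib_left sum.distrib)
qed

text \<open>The relation is linear in its data, so a fixed row of a matrix preserves it. This makes
  an entry of \<open>diff_op\<close> a possible factor in \<open>rk_update_mult\<close>.\<close>

lemma rk_update_diff_op:
  assumes "\<And>l. l < N \<Longrightarrow> rk_update \<tau> I A w (x l) (\<lambda>i. X i l) (\<lambda>i. k i l) (x' l)"
  shows "rk_update \<tau> I A w (diff_op a b N m x j) (\<lambda>i. diff_op a b N m (X i) j)
           (\<lambda>i. diff_op a b N m (k i) j) (diff_op a b N m x' j)"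
proof -
  have X: "X i l = x l + \<tau> * (\<Sum>m\<in>I. A i m * k m l)" if "i \<in> I" "l < N" for i l
    using assms[OF that(2)] that(1) by (simp add: rk_update_def)
  have x': "x' l = x l + \<tau> * (\<Sum>i\<in>I. w i * k i l)" if "l < N" for l
    using assms[OF that] by (simp add: rk_update_def)
  show ?thesis
    unfolding rk_update_def diff_op_def sum_linear_combination[symmetric]
    by (simp add: X x')
qed

section \<open>Symmetries of the differentiation matrices\<close>

text \<open>Each derivative multiplies the mode \<open>l\<close> by \<i> l \<mu>. The equation is
  between functions, since the next derivative needs it at all points.\<close>

lemma funpow_vector_derivative_interp_basis:
  "((\<lambda>g x. vector_derivative g (at x)) ^^ m) (interp_basis a b N k) =
   (\<lambda>x. 1 / of_nat N * (\<Sum>l = - int (N div 2)..int (N div 2).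
       1 / complex_of_real (freq_weight N l) *
       ((\<i> * complex_of_real (of_int l * (2 * pi / (b - a)))) ^ m *
        exp (\<i> * complex_of_real (of_int l * (2 * pi / (b - a)) * (x - mesh_point a b N k))))))"
proof (induction m)
  case 0
  then show ?case by (simp add: interp_basis_def fun_eq_iff)
next
  case (Suc m)
  have exp_deriv:
    "((\<lambda>x. exp (\<i> * complex_of_real (c * (x - p)))) has_vector_derivative
        \<i> * complex_of_real c * exp (\<i> * complex_of_real (c * (x - p)))) (at x)" for c p x :: real
  proof -
    \<comment> \<open>The exponential is differentiated as a complex function and then restricted to
      the real line.\<close>
    have "((\<lambda>z. exp (\<i> * (of_real c * (z - of_real p)))) has_field_derivative
             \<i> * of_real c * exp (\<i> * (of_real c * (of_real x - of_real p)))) (at (of_real x))"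
      by (auto intro!: derivative_eq_intros)
    from has_vector_derivative_real_field[OF this] show ?thesis by simp
  qed
  show ?case
    unfolding funpow.simps o_apply Suc.IH
  proof (intro ext vector_derivative_at)
    fix x
    show "((\<lambda>x. 1 / of_nat N * (\<Sum>l = - int (N div 2)..int (N div 2).
       1 / complex_of_real (freq_weight N l) *
       ((\<i> * complex_of_real (of_int l * (2 * pi / (b - a)))) ^ m *
        exp (\<i> * complex_of_real (of_int l * (2 * pi / (b - a)) * (x - mesh_point a b N k))))))
      has_vector_derivative 1 / of_nat N * (\<Sum>l = - int (N div 2)..int (N div 2).
       1 / complex_of_real (freq_weight N l) *
       ((\<i> * complex_of_real (of_int l * (2 * pi / (b - a)))) ^ Suc m *
        exp (\<i> * complex_of_real (of_int l * (2 * pi / (b - a)) * (x - mesh_point a b N k)))))) (at x)"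
      unfolding power_Suc2 mult.assoc[of "_ ^ m"]
      by (intro has_vector_derivative_mult_right has_vector_derivative_sum exp_deriv)
  qed
qed

lemma diff_matrix_eq:
  "diff_matrix a b N m j k = 1 / of_nat N * (\<Sum>l = - int (N div 2)..int (N div 2).
     1 / complex_of_real (freq_weight N l) *
     ((\<i> * complex_of_real (of_int l * (2 * pi / (b - a)))) ^ m *
      exp (\<i> * complex_of_real (of_int l * (2 * pi / (b - a)) * (mesh_point a b N j - mesh_point a b N k)))))"
  by (simp add: diff_matrix_def funpow_vector_derivative_interp_basis)

lemma sum_symmetric_interval_uminus:
  fixes n :: int
  shows "(\<Sum>l = - n..n. f (- l)) = (\<Sum>l = - n..n. f l)"
  by (rule sum.reindex_bij_witness[of _ uminus uminus]) auto

text \<open>An entry depends only on the difference of its two mesh points. Swapping them flips the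
  sign in the exponential; replacing \<open>l\<close> by \<open>- l\<close> undoes this, keeps the
  weight and costs one sign per derivative.\<close>

lemma diff_matrix_swap: "diff_matrix a b N m k j = (- 1) ^ m * diff_matrix a b N m j k"
proof -
  define \<mu> where "\<mu> = 2 * pi / (b - a)"
  define d where "d = mesh_point a b N j - mesh_point a b N k"
  define f where "f l = 1 / complex_of_real (freq_weight N l) *
     ((\<i> * complex_of_real (of_int l * \<mu>)) ^ m * exp (\<i> * complex_of_real (of_int l * \<mu> * - d)))" for l :: int
  have "f (- l) = (- 1) ^ m * (1 / complex_of_real (freq_weight N l) *
     ((\<i> * complex_of_real (of_int l * \<mu>)) ^ m * exp (\<i> * complex_of_real (of_int l * \<mu> * d))))" for l
  proof -
    have "(\<i> * complex_of_real (of_int (- l) * \<mu>)) ^ m = (- 1) ^ m * (\<i> * complex_of_real (of_int l * \<mu>)) ^ m"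
      by (simp add: power_mult_distrib[symmetric])
    then show ?thesis by (simp add: f_def freq_weight_def)
  qed
  then have "(\<Sum>l = - int (N div 2)..int (N div 2). f l) =
    (- 1) ^ m * (\<Sum>l = - int (N div 2)..int (N div 2). 1 / complex_of_real (freq_weight N l) *
     ((\<i> * complex_of_real (of_int l * \<mu>)) ^ m * exp (\<i> * complex_of_real (of_int l * \<mu> * d))))"
    by (simp only: sum_symmetric_interval_uminus[of f, symmetric] sum_distrib_left)
  then show ?thesis
    unfolding diff_matrix_eq by (simp add: f_def \<mu>_def d_def mult.left_commute)
qed

text \<open>Conjugation exchanges the modes \<open>l\<close> and \<open>- l\<close>, which carry
  equal weights.\<close>

lemma cnj_diff_matrix: "cnj (diff_matrix a b N m j k) = diff_matrix a b N m j k"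
proof -
  define \<mu> where "\<mu> = 2 * pi / (b - a)"
  define d where "d = mesh_point a b N j - mesh_point a b N k"
  define f where "f l = 1 / complex_of_real (freq_weight N l) *
     ((\<i> * complex_of_real (of_int l * \<mu>)) ^ m * exp (\<i> * complex_of_real (of_int l * \<mu> * d)))" for l :: int
  have "cnj (f l) = f (- l)" for l
    by (simp add: f_def freq_weight_def exp_cnj)
  then have "cnj (\<Sum>l = - int (N div 2)..int (N div 2). f l) = (\<Sum>l = - int (N div 2)..int (N div 2). f l)"
    by (simp only: cnj_sum sum_symmetric_interval_uminus)
  then show ?thesis
    unfolding diff_matrix_eq f_def \<mu>_def d_def by simp
qed

lemma cnj_diff_op: "cnj (diff_op a b N m U j) = diff_op a b N m (\<lambda>k. cnj (U k)) j"
  by (simp add: diff_op_def cnj_diff_matrix)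

text \<open>Summation by parts. The form is bilinear, without conjugates, and serves both the
  complex terms with \<open>m = 2\<close> and the real ones with \<open>m = 1\<close>.\<close>

lemma sum_diff_op_mult:
  "(\<Sum>j<N. diff_op a b N m U j * V j) = (- 1) ^ m * (\<Sum>j<N. U j * diff_op a b N m V j)"
proof -
  have "(\<Sum>j<N. diff_op a b N m U j * V j) = (\<Sum>j<N. \<Sum>k<N. diff_matrix a b N m j k * U k * V j)"
    by (simp add: diff_op_def sum_distrib_right)
  also have "\<dots> = (\<Sum>k<N. \<Sum>j<N. diff_matrix a b N m j k * U k * V j)"
    by (rule sum.swap)
  also have "\<dots> = (\<Sum>k<N. \<Sum>j<N. (- 1) ^ m * (U k * (diff_matrix a b N m k j * V j)))"
    by (subst diff_matrix_swap) (simp add: mult_ac)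
  finally show ?thesis by (simp add: diff_op_def sum_distrib_left)
qed

section \<open>Conservation over one step\<close>

lemma rk_step_conservation:
  assumes symp: "\<And>i j. i \<in> {1..s} \<Longrightarrow> j \<in> {1..s} \<Longrightarrow> w i * A i j + w j * A j i = w i * w j"
    and step: "rk_step \<omega> \<kappa> \<nu> \<beta> q a b N \<tau> s A w B \<rho> u \<phi> B' \<rho>' u' \<phi>'"
  shows "mass_h a b N B' = mass_h a b N B"
    and "\<And>j. j < N \<Longrightarrow> H1_h B' \<phi>' j = H1_h B \<phi> j"
    and "energy_h \<omega> \<kappa> \<nu> \<beta> q a b N B' \<rho>' u' \<phi>' = energy_h \<omega> \<kappa> \<nu> \<beta> q a b N B \<rho> u \<phi>"
proof -
  let ?I = "{1..s}"
  let ?c = complex_of_real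
  let ?A = "\<lambda>i j. ?c (A i j)" and ?w = "\<lambda>i. ?c (w i)"
  obtain Bs k1 :: "nat \<Rightarrow> nat \<Rightarrow> complex" and \<rho>s us \<phi>s k2 k3 k4 :: "nat \<Rightarrow> nat \<Rightarrow> real"
    where stages: "\<forall>i\<in>?I. \<forall>j<N.
         Bs i j = B j + ?c \<tau> * (\<Sum>m = 1..s. ?c (A i m) * k1 m j) \<and>
         \<rho>s i j = \<rho> j + \<tau> * (\<Sum>m = 1..s. A i m * k2 m j) \<and>
         us i j = u j + \<tau> * (\<Sum>m = 1..s. A i m * k3 m j) \<and>
         \<phi>s i j = \<phi> j + \<tau> * (\<Sum>m = 1..s. A i m * k4 m j) \<and>
         k1 i j = \<i> * (?c \<omega> * diff_op a b N 2 (Bs i) j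
                    - ?c (\<kappa> * (us i j - 1/2 * \<nu> * \<rho>s i j + q * \<phi>s i j)) * Bs i j) \<and>
         ?c (k2 i j) = diff_op a b N 1 (\<lambda>l. ?c (- us i l + \<nu> * \<rho>s i l - \<kappa> * \<phi>s i l)) j \<and>
         ?c (k3 i j) = diff_op a b N 1 (\<lambda>l. ?c (- \<beta> * \<rho>s i l + \<nu> * us i l + 1/2 * \<kappa> * \<nu> * \<phi>s i l)) j \<and>
         k4 i j = 2 * Re (cnj (Bs i j) * k1 i j)"
      and update: "\<forall>j<N.
         B' j = B j + ?c \<tau> * (\<Sum>i = 1..s. ?c (w i) * k1 i j) \<and>
         \<rho>' j = \<rho> j + \<tau> * (\<Sum>i = 1..s. w i * k2 i j) \<and>
         u' j = u j + \<tau> * (\<Sum>i = 1..s. w i * k3 i j) \<and>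
         \<phi>' j = \<phi> j + \<tau> * (\<Sum>i = 1..s. w i * k4 i j)"
    using step unfolding rk_step_def by blast
  define D where "D i j = diff_op a b N 2 (Bs i) j" for i j
  define Dk where "Dk i j = diff_op a b N 2 (k1 i) j" for i j
  \<comment> \<open>\<open>- G\<close> is the derivative of the energy density with respect to
    \<phi>, just as \<open>P\<close> and \<open>Q\<close> belong to u and \<rho>. That
    \<open>G\<close> is real matters for the cancellations below.\<close>
  define G where "G i j = \<kappa> * (us i j - 1/2 * \<nu> * \<rho>s i j + q * \<phi>s i j)" for i j
  define P where "P i j = - us i j + \<nu> * \<rho>s i j - \<kappa> * \<phi>s i j" for i j
  define Q where "Q i j = - \<beta> * \<rho>s i j + \<nu> * us i j + 1/2 * \<kappa> * \<nu> * \<phi>s i j" for i j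

  have csymp: "?w i * ?A i j + ?w j * ?A j i = ?w i * ?w j" if "i \<in> ?I" "j \<in> ?I" for i j
    using symp[OF that] by (metis of_real_add of_real_mult)
  have upB: "rk_update (?c \<tau>) ?I ?A ?w (B j) (\<lambda>i. Bs i j) (\<lambda>i. k1 i j) (B' j)" if "j < N" for j
    unfolding rk_update_def using stages update that by blast
  note upcB = rk_update_cnj[OF upB]
  have upD: "rk_update (?c \<tau>) ?I ?A ?w (diff_op a b N 2 B j) (\<lambda>i. D i j) (\<lambda>i. Dk i j) (diff_op a b N 2 B' j)" for j
    unfolding D_def Dk_def by (rule rk_update_diff_op) (rule upB)
  have up\<rho>: "rk_update (?c \<tau>) ?I ?A ?w (?c (\<rho> j)) (\<lambda>i. ?c (\<rho>s i j)) (\<lambda>i. ?c (k2 i j)) (?c (\<rho>' j))"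
    and upu: "rk_update (?c \<tau>) ?I ?A ?w (?c (u j)) (\<lambda>i. ?c (us i j)) (\<lambda>i. ?c (k3 i j)) (?c (u' j))"
    and up\<phi>: "rk_update (?c \<tau>) ?I ?A ?w (?c (\<phi> j)) (\<lambda>i. ?c (\<phi>s i j)) (\<lambda>i. ?c (k4 i j)) (?c (\<phi>' j))"
    if "j < N" for j
    using stages update that by (intro rk_update_of_real; blast)+
  have mult: "x' * y' = x * y + ?c \<tau> * (\<Sum>i\<in>?I. ?w i * (X i * l i + k i * Y i))"
    if "rk_update (?c \<tau>) ?I ?A ?w x X k x'" "rk_update (?c \<tau>) ?I ?A ?w y Y l y'" for x X k x' y Y l y'
    using that csymp by (rule rk_update_mult)

  have k1: "k1 i j = \<i> * (?c \<omega> * D i j - ?c (G i j) * Bs i j)"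
    and k2: "?c (k2 i j) = diff_op a b N 1 (\<lambda>l. ?c (P i l)) j"
    and k3: "?c (k3 i j) = diff_op a b N 1 (\<lambda>l. ?c (Q i l)) j"
    and k4: "?c (k4 i j) = Bs i j * cnj (k1 i j) + k1 i j * cnj (Bs i j)"
    if "i \<in> ?I" "j < N" for i j
  proof -
    note st = stages[rule_format, OF that]
    show "k1 i j = \<i> * (?c \<omega> * D i j - ?c (G i j) * Bs i j)"
      using st unfolding D_def G_def by blast
    show "?c (k2 i j) = diff_op a b N 1 (\<lambda>l. ?c (P i l)) j"
      using st unfolding P_def by blast
    show "?c (k3 i j) = diff_op a b N 1 (\<lambda>l. ?c (Q i l)) j"
      using st unfolding Q_def by blast
    have "k4 i j = 2 * Re (cnj (Bs i j) * k1 i j)" using st by blast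
    then show "?c (k4 i j) = Bs i j * cnj (k1 i j) + k1 i j * cnj (Bs i j)"
      by (simp add: complex_eq_iff algebra_simps)
  qed

  have D_adj: "(\<Sum>j<N. Dk i j * cnj (Bs i j)) = (\<Sum>j<N. k1 i j * cnj (D i j))" for i
    using sum_diff_op_mult[of a b N 2 "k1 i" "\<lambda>j. cnj (Bs i j)"]
    by (simp add: Dk_def D_def cnj_diff_op)
  \<comment> \<open>The two sides are conjugates of each other, so the quadratic form of
    \<open>D\<^sub>2\<close> is real.\<close>
  have D_herm: "(\<Sum>j<N. D i j * cnj (Bs i j)) = (\<Sum>j<N. Bs i j * cnj (D i j))" for i
    using sum_diff_op_mult[of a b N 2 "Bs i" "\<lambda>j. cnj (Bs i j)"]
    by (simp add: D_def cnj_diff_op)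

  \<comment> \<open>By \<open>k4\<close> the product rule for \<open>B * cnj B\<close> has exactly
    the stage rate used for \<phi>, so both receive the same increment.\<close>
  have density: "abs_sq B' j = abs_sq B j + ?c \<tau> * (\<Sum>i\<in>?I. ?w i * ?c (k4 i j))" if "j < N" for j
    using mult[OF upB[OF that] upcB[OF that]] that by (simp add: abs_sq_def k4)
  show "H1_h B' \<phi>' j = H1_h B \<phi> j" if "j < N" for j
    using density[OF that] up\<phi>[OF that] by (simp add: H1_h_def rk_update_def)

  \<comment> \<open>The rates of mass and energy vanish only after summation over the mesh,
    separately at each stage; hence the exchange of sums.\<close>
  have swap: "(\<Sum>j<N. \<Sum>i\<in>?I. ?w i * r i j) = 0" if "\<And>i. i \<in> ?I \<Longrightarrow> (\<Sum>j<N. r i j) = 0" for r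
    by (subst sum.swap) (simp add: sum_distrib_left[symmetric] that)

  have mass_rate: "(\<Sum>j<N. ?c (k4 i j)) = 0" if "i \<in> ?I" for i
  proof -
    \<comment> \<open>The contributions of the real factor \<open>G\<close> cancel
      pointwise.\<close>
    have "(\<Sum>j<N. ?c (k4 i j)) = (\<Sum>j<N. \<i> * ?c \<omega> * (D i j * cnj (Bs i j) - Bs i j * cnj (D i j)))"
      using that by (intro sum.cong refl) (simp add: k4 k1 algebra_simps)
    also have "\<dots> = 0"
      by (simp add: sum_distrib_left[symmetric] sum_subtractf D_herm)
    finally show ?thesis .
  qed
  have "(\<Sum>j<N. abs_sq B' j) = (\<Sum>j<N. abs_sq B j) + ?c \<tau> * (\<Sum>j<N. \<Sum>i\<in>?I. ?w i * ?c (k4 i j))"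
    by (simp add: density sum.distrib sum_distrib_left)
  then show "mass_h a b N B' = mass_h a b N B"
    by (simp only: swap[OF mass_rate]) (simp add: mass_h_def inner_h_def)

  \<comment> \<open>The energy density is split into products of two components so that
    \<open>mult\<close> applies to each; \<open>r\<close> is its stage rate by the product
    rule.\<close>
  define e where "e B \<rho> u \<phi> j = ?c \<omega> * (diff_op a b N 2 B j * cnj (B j))
      - ?c \<kappa> * (?c (u j) * ?c (\<phi> j)) + ?c (\<kappa> * \<nu> / 2) * (?c (\<rho> j) * ?c (\<phi> j))
      - ?c (\<kappa> * q / 2) * (?c (\<phi> j) * ?c (\<phi> j)) - ?c (\<beta> / 2) * (?c (\<rho> j) * ?c (\<rho> j))
      - ?c (1 / 2) * (?c (u j) * ?c (u j)) + ?c \<nu> * (?c (u j) * ?c (\<rho> j))" for B \<rho> u \<phi> j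
  define r where "r i j = ?c \<omega> * (D i j * cnj (k1 i j) + Dk i j * cnj (Bs i j))
      - ?c \<kappa> * (?c (us i j) * ?c (k4 i j) + ?c (k3 i j) * ?c (\<phi>s i j))
      + ?c (\<kappa> * \<nu> / 2) * (?c (\<rho>s i j) * ?c (k4 i j) + ?c (k2 i j) * ?c (\<phi>s i j))
      - ?c (\<kappa> * q / 2) * (?c (\<phi>s i j) * ?c (k4 i j) + ?c (k4 i j) * ?c (\<phi>s i j))
      - ?c (\<beta> / 2) * (?c (\<rho>s i j) * ?c (k2 i j) + ?c (k2 i j) * ?c (\<rho>s i j))
      - ?c (1 / 2) * (?c (us i j) * ?c (k3 i j) + ?c (k3 i j) * ?c (us i j))
      + ?c \<nu> * (?c (us i j) * ?c (k2 i j) + ?c (k3 i j) * ?c (\<rho>s i j))" for i j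
  have energy_eq: "energy_h \<omega> \<kappa> \<nu> \<beta> q a b N B \<rho> u \<phi> = ?c (mesh_size a b N) * (\<Sum>j<N. e B \<rho> u \<phi> j)"
    for B \<rho> u \<phi>
    by (simp add: energy_h_def inner_h_def e_def sum_distrib_left sum.distrib sum_subtractf algebra_simps)
  have e_step: "e B' \<rho>' u' \<phi>' j = e B \<rho> u \<phi> j + ?c \<tau> * (\<Sum>i\<in>?I. ?w i * r i j)" if "j < N" for j
  proof -
    note ups = upcB[OF that] up\<rho>[OF that] upu[OF that] up\<phi>[OF that]
    have rate: "(\<Sum>i\<in>?I. ?w i * r i j) =
        ?c \<omega> * (\<Sum>i\<in>?I. ?w i * (D i j * cnj (k1 i j) + Dk i j * cnj (Bs i j)))
      - ?c \<kappa> * (\<Sum>i\<in>?I. ?w i * (?c (us i j) * ?c (k4 i j) + ?c (k3 i j) * ?c (\<phi>s i j)))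
      + ?c (\<kappa> * \<nu> / 2) * (\<Sum>i\<in>?I. ?w i * (?c (\<rho>s i j) * ?c (k4 i j) + ?c (k2 i j) * ?c (\<phi>s i j)))
      - ?c (\<kappa> * q / 2) * (\<Sum>i\<in>?I. ?w i * (?c (\<phi>s i j) * ?c (k4 i j) + ?c (k4 i j) * ?c (\<phi>s i j)))
      - ?c (\<beta> / 2) * (\<Sum>i\<in>?I. ?w i * (?c (\<rho>s i j) * ?c (k2 i j) + ?c (k2 i j) * ?c (\<rho>s i j)))
      - ?c (1 / 2) * (\<Sum>i\<in>?I. ?w i * (?c (us i j) * ?c (k3 i j) + ?c (k3 i j) * ?c (us i j)))
      + ?c \<nu> * (\<Sum>i\<in>?I. ?w i * (?c (us i j) * ?c (k2 i j) + ?c (k3 i j) * ?c (\<rho>s i j)))"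
      unfolding sum_distrib_left sum.distrib[symmetric] sum_subtractf[symmetric]
      by (intro sum.cong refl) (simp only: r_def distrib_left right_diff_distrib mult.left_commute)
    show ?thesis
      unfolding rate
      unfolding e_def mult[OF upD ups(1)] mult[OF ups(3) ups(4)] mult[OF ups(2) ups(4)]
        mult[OF ups(4) ups(4)] mult[OF ups(2) ups(2)] mult[OF ups(3) ups(3)] mult[OF ups(3) ups(2)]
      by (simp only: algebra_simps)
  qed
  have energy_rate: "(\<Sum>j<N. r i j) = 0" if i: "i \<in> ?I" for i
  proof -
    \<comment> \<open>The term \<open>k1 i j * cnj (D i j)\<close> is added and subtracted: with a
      plus sign it joins the pointwise cancellation, with a minus sign it is matched against
      \<open>Dk\<close> by \<open>D_adj\<close>.\<close>
    have "r i j = ?c \<omega> * (Dk i j * cnj (Bs i j) - k1 i j * cnj (D i j))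
        + (diff_op a b N 1 (\<lambda>l. ?c (Q i l)) j * ?c (P i j) + ?c (Q i j) * diff_op a b N 1 (\<lambda>l. ?c (P i l)) j)"
      if j: "j < N" for j
    proof -
      let ?Z = "?c \<omega> * D i j - ?c (G i j) * Bs i j"
      \<comment> \<open>As \<open>k1\<close> is \<i> times \<open>?Z\<close>, the two terms are
        opposite multiples of the squared modulus of \<open>?Z\<close>.\<close>
      have "cnj (k1 i j) * ?Z + k1 i j * cnj ?Z = 0"
        by (simp add: k1[OF i j] algebra_simps)
      then have "?c \<omega> * (D i j * cnj (k1 i j) + k1 i j * cnj (D i j)) = ?c (G i j) * ?c (k4 i j)"
        by (simp add: k4[OF i j] algebra_simps)
      \<comment> \<open>Collecting the increments: \<open>k4\<close> has total coefficient
        \<open>- G\<close>, \<open>k3\<close> has \<open>P\<close> and \<open>k2\<close> has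
        \<open>Q\<close>.\<close>
      moreover have "r i j = (?c \<omega> * (D i j * cnj (k1 i j) + k1 i j * cnj (D i j)) - ?c (G i j) * ?c (k4 i j))
          + ?c \<omega> * (Dk i j * cnj (Bs i j) - k1 i j * cnj (D i j))
          + (?c (k3 i j) * ?c (P i j) + ?c (Q i j) * ?c (k2 i j))"
        by (simp add: r_def G_def P_def Q_def field_simps)
      ultimately show ?thesis
        unfolding k2[OF i j, symmetric] k3[OF i j, symmetric] by simp
    qed
    then have "(\<Sum>j<N. r i j) = ?c \<omega> * ((\<Sum>j<N. Dk i j * cnj (Bs i j)) - (\<Sum>j<N. k1 i j * cnj (D i j)))
        + ((\<Sum>j<N. diff_op a b N 1 (\<lambda>l. ?c (Q i l)) j * ?c (P i j))
         + (\<Sum>j<N. ?c (Q i j) * diff_op a b N 1 (\<lambda>l. ?c (P i l)) j))"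
      by (simp add: sum.distrib sum_distrib_left[symmetric] sum_subtractf)
    then show ?thesis
      \<comment> \<open>The sign for \<open>m = 1\<close> makes the last two sums opposite.\<close>
      by (simp add: D_adj sum_diff_op_mult)
  qed
  have "(\<Sum>j<N. e B' \<rho>' u' \<phi>' j) = (\<Sum>j<N. e B \<rho> u \<phi> j) + ?c \<tau> * (\<Sum>j<N. \<Sum>i\<in>?I. ?w i * r i j)"
    by (simp add: e_step sum.distrib sum_distrib_left)
  then show "energy_h \<omega> \<kappa> \<nu> \<beta> q a b N B' \<rho>' u' \<phi>' = energy_h \<omega> \<kappa> \<nu> \<beta> q a b N B \<rho> u \<phi>"
    by (simp only: swap[OF energy_rate] energy_eq) simp
qed

theorem theorem3p2:
  fixes \<omega> \<kappa> \<nu> \<beta> q a b \<tau> :: real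
    and N s :: nat
    and A :: "nat \<Rightarrow> nat \<Rightarrow> real" and w :: "nat \<Rightarrow> real"
    and B :: "nat \<Rightarrow> nat \<Rightarrow> complex"
    and \<rho> u \<phi> :: "nat \<Rightarrow> nat \<Rightarrow> real"
  assumes "\<beta> \<noteq> \<nu>\<^sup>2"
    and "q = \<kappa> + \<nu> * (\<kappa> * \<nu> - 1) / (4 * (\<beta> - \<nu>\<^sup>2))"
    and "a < b" and "N > 0" and "even N" and "\<tau> > 0" and "s \<ge> 1"
    and "\<And>i j. i \<in> {1..s} \<Longrightarrow> j \<in> {1..s} \<Longrightarrow> w i * A i j + w j * A j i = w i * w j"
    and "\<And>n. rk_step \<omega> \<kappa> \<nu> \<beta> q a b N \<tau> s A w
               (B n) (\<rho> n) (u n) (\<phi> n) (B (Suc n)) (\<rho> (Suc n)) (u (Suc n)) (\<phi> (Suc n))"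
    and "\<And>j. j < N \<Longrightarrow> complex_of_real (\<phi> 0 j) = abs_sq (B 0) j"
  shows "\<forall>n.
      mass_h a b N (B (Suc n)) = mass_h a b N (B n) \<and>
      (\<forall>j<N. H1_h (B (Suc n)) (\<phi> (Suc n)) j = H1_h (B n) (\<phi> n) j \<and> H1_h (B n) (\<phi> n) j = 0) \<and>
      energy_h \<omega> \<kappa> \<nu> \<beta> q a b N (B (Suc n)) (\<rho> (Suc n)) (u (Suc n)) (\<phi> (Suc n))
        = energy_h \<omega> \<kappa> \<nu> \<beta> q a b N (B n) (\<rho> n) (u n) (\<phi> n)"
proof -
  note step = rk_step_conservation[OF assms(8) assms(9)]
  \<comment> \<open>A step only transports the value of \<open>H1_h\<close>; that it is zero comes
    from the initial data.\<close>
  have "\<forall>j<N. H1_h (B n) (\<phi> n) j = 0" for n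
  proof (induction n)
    case 0
    then show ?case using assms(10) by (simp add: H1_h_def)
  next
    case (Suc n)
    then show ?case using step(2) by simp
  qed
  then show ?thesis using step by simp
qed

end
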